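(* Let $(y_m)_{m\geq1}$ be a sequence of real numbers that is equidistributed modulo $1$. Let $\psi:\mathbb{Z}_{\geq1}\to[0,\infty)$ be such that $\sum_{n\geq1}\psi(n)$ diverges. Then for every $R>0$ and $\varepsilon>0$ there is a set $S$ of positive integers of asymptotic density $1$ such that for every $m\in S$, the set of real $x$ for which the inequality $\|nx+y_m\|<\psi(n)$ has at least $R$ integer solutions $n\geq1$ has measure at least $1-\varepsilon$.
   Context: For a real number $t$, $\|t\|$ denotes the distance from $t$ to the nearest integer. The sets of $x$ in question are $1$-periodic; the measure of a $1$-periodic set of reals means the Lebesgue measure of its intersection with $[0,1)$. *)

theory Defs
  imports "HOL-Analysis.Analysis"
begin

definition dist_nearest_int :: "real \<Rightarrow> real" where
  "dist_nearest_int t = infdist t \<int>"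

text \<open>Sequences are indexed by the positive integers; the value at 0 is never used.\<close>

definition equidistributed_mod_1 :: "(nat \<Rightarrow> real) \<Rightarrow> bool" where
  "equidistributed_mod_1 y \<longleftrightarrow>
     (\<forall>a b. 0 \<le> a \<and> a < b \<and> b \<le> 1 \<longrightarrow>
        (\<lambda>N. real (card {m \<in> {1..N}. frac (y m) \<in> {a..<b}}) / real N) \<longlonglongrightarrow> b - a)"

definition has_asymptotic_density :: "nat set \<Rightarrow> real \<Rightarrow> bool" where
  "has_asymptotic_density S d \<longleftrightarrow>
     (\<lambda>N. real (card (S \<inter> {1..N})) / real N) \<longlonglongrightarrow> d"

definition periodic_measure :: "real set \<Rightarrow> real" where
  "periodic_measure A = measure lebesgue (A \<inter> {0..<1})"

text \<open>Finiteness of the set of solutions is not assumed, and \<^const>\<open>card\<close> is 0 on infinite sets;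
  hence the lower bound on the number of elements is expressed by a finite subset.\<close>

definition has_at_least :: "real \<Rightarrow> 'a set \<Rightarrow> bool" where
  "has_at_least R A \<longleftrightarrow> (\<exists>F. F \<subseteq> A \<and> finite F \<and> R \<le> real (card F))"

definition approx_solutions :: "(nat \<Rightarrow> real) \<Rightarrow> real \<Rightarrow> real \<Rightarrow> nat set" where
  "approx_solutions \<psi> c x = {n. 1 \<le> n \<and> dist_nearest_int (real n * x + c) < \<psi> n}"

end

theory Submission
  imports Defs "HOL-Probability.Probability"
begin

text \<open>
  Choose the shift \<^term>\<open>c\<close> and the point \<^term>\<open>x\<close> independently and uniformly in the unit interval.
  After truncating \<open>\<psi>\<close> at \<open>1/2\<close>, the events \<open>\<parallel>n x + c\<parallel> < \<psi> n\<close> have probability \<open>2 \<psi> n\<close> and are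
  pairwise independent, so by Chebyshev's inequality almost every \<^term>\<open>(c, x)\<close> lies in infinitely
  many of them. The set of \<^term>\<open>(c, x)\<close> with at least \<open>R\<close> solutions is open. Hence so is the set \<open>G\<close>
  of those \<^term>\<open>c\<close> for which the solvable \<^term>\<open>x\<close> have measure greater than \<open>1 - \<epsilon>\<close>, and \<open>G\<close> has full
  measure. An equidistributed sequence visits an open set of full measure with density \<open>1\<close>, because
  such a set contains finite unions of intervals of measure arbitrarily close to \<open>1\<close>.
\<close>

section \<open>A second Borel-Cantelli lemma for pairwise independent events\<close>

text \<open>Second moment method: pairwise independence bounds the variance of the partial count
  \<open>X N\<close> by its mean \<open>\<mu> N\<close>. Chebyshev then shows that the count stays
  below a fixed \<open>k\<close> with probability at most \<open>4 / \<mu> N\<close> for large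
  \<open>N\<close>, and \<open>\<mu> N\<close> is unbounded.\<close>

lemma (in prob_space) borel_cantelli_pairwise_indep:
  fixes A :: "nat \<Rightarrow> 'a set"
  assumes A[measurable]: "\<And>n. A n \<in> events"
    and indep: "\<And>m n. m < n \<Longrightarrow> prob (A m \<inter> A n) = prob (A m) * prob (A n)"
    and div: "\<not> summable (\<lambda>n. prob (A n))"
  shows "AE x in M. infinite {n. x \<in> A n}"
proof -
  define X where "X N x = (\<Sum>n<N. indicator (A n) x :: real)" for N x
  define \<mu> where "\<mu> N = (\<Sum>n<N. prob (A n))" for N
  have [measurable]: "X N \<in> borel_measurable M" for N
    unfolding X_def by measurable
  have int_ind: "integrable M (indicator (A n) :: 'a \<Rightarrow> real)" for n
    by (simp add: less_top[symmetric])
  have EX: "expectation (X N) = \<mu> N" for N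
    unfolding X_def \<mu>_def by (subst Bochner_Integration.integral_sum) (auto simp: int_ind)
  have sq: "(X N x)\<^sup>2 = (\<Sum>m<N. \<Sum>n<N. indicator (A m \<inter> A n) x)" for N x
    unfolding X_def power2_eq_square sum_product by (simp add: indicator_inter_arith)
  have int_sq: "integrable M (\<lambda>x. (X N x)\<^sup>2)" for N
    unfolding sq by (intro Bochner_Integration.integrable_sum) (simp add: less_top[symmetric])
  \<comment> \<open>The diagonal terms equal \<open>prob (A n)\<close> instead of a product; the
    extra summand pays for them and adds up to \<open>\<mu> N\<close>.\<close>
  have indep': "prob (A m \<inter> A n) \<le> prob (A m) * prob (A n) + (if m = n then prob (A n) else 0)" for m n
    using indep[of m n] indep[of n m]
    by (cases m n rule: linorder_cases) (auto simp: Int_commute mult.commute)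
  have "expectation (\<lambda>x. (X N x)\<^sup>2) = (\<Sum>m<N. \<Sum>n<N. prob (A m \<inter> A n))" for N
    unfolding sq
    by (subst Bochner_Integration.integral_sum, simp add: less_top[symmetric])+ simp
  also have "\<dots> N \<le> (\<Sum>m<N. \<Sum>n<N. prob (A m) * prob (A n) + (if m = n then prob (A n) else 0))" for N
    by (intro sum_mono indep')
  also have "\<dots> N = (\<mu> N)\<^sup>2 + \<mu> N" for N
    by (simp add: sum.distrib \<mu>_def power2_eq_square sum_product)
  finally have EX2: "expectation (\<lambda>x. (X N x)\<^sup>2) \<le> (\<mu> N)\<^sup>2 + \<mu> N" for N .
  have var: "variance (X N) \<le> \<mu> N" for N
  proof -
    have "integrable M (X N)"
      unfolding X_def by (intro Bochner_Integration.integrable_sum int_ind)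
    then show ?thesis
      using EX2[of N] by (subst variance_eq) (auto simp: int_sq EX)
  qed
  \<comment> \<open>A point lying in only finitely many \<open>A n\<close> belongs to some
    \<open>B k\<close>, so it suffices that every \<open>B k\<close> is null.\<close>
  define B where "B k = {x \<in> space M. \<forall>N. X N x \<le> real k}" for k :: nat
  have [measurable]: "B k \<in> events" for k
    unfolding B_def by measurable
  have B_null: "prob (B k) = 0" for k
  proof (rule ccontr)
    assume "prob (B k) \<noteq> 0"
    then have pos: "prob (B k) > 0"
      by (simp add: zero_less_measure_iff)
    \<comment> \<open>For \<open>\<mu> N > C\<close>, the summand \<open>2 * real k\<close> gives
      \<open>\<mu> N - k \<ge> \<mu> N / 2\<close>, and \<open>5 / prob (B k)\<close> makes the
      Chebyshev bound \<open>4 / \<mu> N\<close> smaller than \<open>prob (B k)\<close>.\<close>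
    define C where "C = 2 * real k + 1 + 5 / prob (B k)"
    obtain N where N: "\<mu> N > C"
    proof (rule ccontr)
      assume "\<not> thesis"
      then have "\<And>N. (\<Sum>n<N. norm (prob (A n))) \<le> C"
        using that by (fastforce simp: \<mu>_def not_less)
      then have "summable (\<lambda>n. norm (prob (A n)))"
        by (intro summableI_nonneg_bounded[where x = C]) auto
      with div show False by simp
    qed
    have C: "C \<ge> 2 * real k" "C \<ge> 1" "C > 4 / prob (B k)"
    proof -
      have "4 / prob (B k) < 5 / prob (B k)" "0 < 4 / prob (B k)"
        using pos by (simp_all add: divide_strict_right_mono)
      then show "C \<ge> 2 * real k" "C \<ge> 1" "C > 4 / prob (B k)"
        unfolding C_def by linarith+
    qed
    have half: "\<mu> N / 2 > 0" "\<mu> N / 2 \<le> \<mu> N - real k"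
      using N C by linarith+
    have "prob (B k) \<le> prob {x \<in> space M. \<mu> N / 2 \<le> \<bar>X N x - expectation (X N)\<bar>}"
    proof (rule finite_measure_mono)
      show "B k \<subseteq> {x \<in> space M. \<mu> N / 2 \<le> \<bar>X N x - expectation (X N)\<bar>}"
      proof
        fix x assume "x \<in> B k"
        then have "x \<in> space M" "X N x \<le> real k" by (auto simp: B_def)
        then show "x \<in> {x \<in> space M. \<mu> N / 2 \<le> \<bar>X N x - expectation (X N)\<bar>}"
          using half by (simp add: EX)
      qed
    qed measurable
    also have "\<dots> \<le> variance (X N) / (\<mu> N / 2)\<^sup>2"
      using half by (intro Chebyshev_inequality int_sq) auto
    also have "\<dots> \<le> \<mu> N / (\<mu> N / 2)\<^sup>2"
      by (intro divide_right_mono var) auto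
    also have "\<dots> = 4 / \<mu> N"
      using half by (simp add: power2_eq_square)
    also have "\<dots> < prob (B k)"
      using N C pos half by (simp add: field_simps) (smt (verit) mult_less_cancel_right_pos mult.commute)
    finally show False by simp
  qed
  have "AE x in M. \<forall>k. x \<notin> B k"
    unfolding AE_all_countable
    by (intro allI AE_not_in) (simp add: null_sets_def emeasure_eq_measure B_null)
  with AE_space show ?thesis
  proof eventually_elim
    case (elim x)
    show ?case
    proof
      assume fin: "finite {n. x \<in> A n}"
      have "X N x \<le> card {n. x \<in> A n}" for N
      proof -
        have "X N x = card ({n. x \<in> A n} \<inter> {..<N})"
          unfolding X_def by (simp add: indicator_def sum.If_cases Int_commute)
        also have "\<dots> \<le> card {n. x \<in> A n}"
          using fin by (intro of_nat_mono card_mono) auto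
        finally show ?thesis .
      qed
      then show False
        using elim by (auto simp: B_def)
    qed
  qed
qed

section \<open>Distance to the nearest integer\<close>

text \<open>The integers form a closed set, so the infimum defining the distance is
  attained.\<close>

lemma dist_nearest_int_less_iff: "dist_nearest_int t < p \<longleftrightarrow> (\<exists>k::int. \<bar>t - of_int k\<bar> < p)"
proof
  assume "dist_nearest_int t < p"
  moreover obtain z where "z \<in> (\<int> :: real set)" "infdist t \<int> = dist t z"
    using infdist_attains_inf[of "\<int> :: real set" t] closed_Ints Ints_0 by blast
  ultimately show "\<exists>k::int. \<bar>t - of_int k\<bar> < p"
    by (auto simp: dist_nearest_int_def dist_real_def elim!: Ints_cases)
next
  assume "\<exists>k::int. \<bar>t - of_int k\<bar> < p"
  then obtain k :: int where "\<bar>t - of_int k\<bar> < p" ..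
  moreover have "infdist t \<int> \<le> dist t (of_int k)"
    by (rule infdist_le) simp
  ultimately show "dist_nearest_int t < p"
    by (simp add: dist_nearest_int_def dist_real_def)
qed

lemma dist_nearest_int_add_int [simp]: "dist_nearest_int (t + of_int k) = dist_nearest_int t"
proof -
  have "dist_nearest_int (t + of_int k) < p \<longleftrightarrow> dist_nearest_int t < p" for p
    unfolding dist_nearest_int_less_iff
    by (metis (no_types, opaque_lifting) add_diff_cancel_right diff_add_cancel of_int_add)
  then show ?thesis
    by (metis less_irrefl not_less_iff_gr_or_eq)
qed

lemma continuous_on_dist_nearest_int [continuous_intros]:
  "continuous_on S f \<Longrightarrow> continuous_on S (\<lambda>x. dist_nearest_int (f x))"
  unfolding dist_nearest_int_def by (rule continuous_on_infdist)

lemma measurable_dist_nearest_int [measurable]: "dist_nearest_int \<in> borel_measurable borel"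
  by (intro borel_measurable_continuous_onI continuous_intros)

section \<open>Integrals of periodic functions over the unit interval\<close>

abbreviation unit_uniform :: "real measure" where
  "unit_uniform \<equiv> uniform_measure lborel {0..<1}"

lemma prob_space_unit_uniform: "prob_space unit_uniform"
  by (rule prob_space_uniform_measure) auto

interpretation unit_uniform: prob_space unit_uniform
  by (rule prob_space_unit_uniform)

interpretation unit_uniform_pair: pair_prob_space unit_uniform unit_uniform ..

lemma nn_integral_unit_uniform:
  assumes [measurable]: "f \<in> borel_measurable borel"
  shows "(\<integral>\<^sup>+t. f t \<partial>unit_uniform) = (\<integral>\<^sup>+t\<in>{0..<1}. f t \<partial>lborel)"
  by (subst nn_integral_uniform_measure) (auto simp: divide_ennreal_def)

text \<open>With \<open>b = frac a\<close>, cut the unit interval at \<open>1 - b\<close>.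
  Translation by \<open>b\<close> sends the left piece to \<open>[b, 1)\<close>; the right piece
  leaves the interval and is brought back to \<open>[0, b)\<close> by periodicity.\<close>

lemma nn_integral_unit_uniform_shift:
  fixes g :: "real \<Rightarrow> ennreal"
  assumes [measurable]: "g \<in> borel_measurable borel"
    and per: "\<And>t (k::int). g (t + of_int k) = g t"
  shows "(\<integral>\<^sup>+t. g (t + a) \<partial>unit_uniform) = (\<integral>\<^sup>+t. g t \<partial>unit_uniform)"
proof -
  define b where "b = frac a"
  have b: "0 \<le> b" "b < 1" by (auto simp: b_def frac_lt_1)
  have ga: "g (t + a) = g (t + b)" for t
    using per[of "t + b" "\<lfloor>a\<rfloor>"] by (simp add: b_def frac_def)
  have split: "(\<integral>\<^sup>+t\<in>{0..<1}. f t \<partial>lborel) =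
      (\<integral>\<^sup>+t\<in>{0..<s}. f t \<partial>lborel) + (\<integral>\<^sup>+t\<in>{s..<1}. f t \<partial>lborel)"
    if [measurable]: "f \<in> borel_measurable borel" and "0 \<le> s" "s \<le> 1"
    for s and f :: "real \<Rightarrow> ennreal"
    using that by (subst nn_integral_add[symmetric]) (auto intro!: nn_integral_cong simp: indicator_def)
  have "(\<integral>\<^sup>+t\<in>{0..<1}. g (t + b) \<partial>lborel) =
      (\<integral>\<^sup>+t\<in>{0..<1-b}. g (t + b) \<partial>lborel) + (\<integral>\<^sup>+t\<in>{1-b..<1}. g (t + b) \<partial>lborel)"
    using b by (intro split) auto
  also have "(\<integral>\<^sup>+t\<in>{0..<1-b}. g (t + b) \<partial>lborel) = (\<integral>\<^sup>+t\<in>{b..<1}. g t \<partial>lborel)"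
    by (subst nn_integral_real_affine[of "\<lambda>t. g t * indicator {b..<1} t" 1 b])
      (auto intro!: nn_integral_cong simp: indicator_def add.commute)
  also have "(\<integral>\<^sup>+t\<in>{1-b..<1}. g (t + b) \<partial>lborel) = (\<integral>\<^sup>+t\<in>{0..<b}. g t \<partial>lborel)"
  proof (subst nn_integral_real_affine[of "\<lambda>t. g t * indicator {0..<b} t" 1 "b - 1"])
    have "g (t + b) = g (b - 1 + t)" for t
      using per[of "b - 1 + t" 1] by (simp add: add.commute)
    then show "(\<integral>\<^sup>+t\<in>{1-b..<1}. g (t + b) \<partial>lborel) =
        ennreal \<bar>1\<bar> * (\<integral>\<^sup>+t. g (b - 1 + 1 * t) * indicator {0..<b} (b - 1 + 1 * t) \<partial>lborel)"
      by (auto intro!: nn_integral_cong simp: indicator_def)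
  qed auto
  also have "(\<integral>\<^sup>+t\<in>{b..<1}. g t \<partial>lborel) + (\<integral>\<^sup>+t\<in>{0..<b}. g t \<partial>lborel) = (\<integral>\<^sup>+t\<in>{0..<1}. g t \<partial>lborel)"
    using b by (subst split[of g b]) (auto simp: add.commute)
  finally show ?thesis
    by (simp add: nn_integral_unit_uniform ga)
qed

text \<open>Dilation stretches the unit interval to \<open>[0, k)\<close>, which splits into
  \<open>k\<close> unit intervals with equal integrals; the factor \<open>k\<close> from the
  substitution cancels this multiplicity.\<close>

lemma nn_integral_unit_uniform_dilate:
  fixes g :: "real \<Rightarrow> ennreal"
  assumes [measurable]: "g \<in> borel_measurable borel"
    and per: "\<And>t (k::int). g (t + of_int k) = g t"
    and k: "k > (0::nat)"
  shows "(\<integral>\<^sup>+t. g (real k * t) \<partial>unit_uniform) = (\<integral>\<^sup>+t. g t \<partial>unit_uniform)"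
proof -
  have step: "(\<integral>\<^sup>+t\<in>{real j..<real j + 1}. g t \<partial>lborel) = (\<integral>\<^sup>+t\<in>{0..<1}. g t \<partial>lborel)" for j
  proof (subst nn_integral_real_affine[of "\<lambda>t. g t * indicator {real j..<real j + 1} t" 1 "real j"])
    have "g (real j + t) = g t" for t
      using per[of t "int j"] by (simp add: add.commute)
    then show "ennreal \<bar>1\<bar> * (\<integral>\<^sup>+t. g (real j + 1 * t) * indicator {real j..<real j + 1} (real j + 1 * t) \<partial>lborel)
        = (\<integral>\<^sup>+t\<in>{0..<1}. g t \<partial>lborel)"
      by (auto intro!: nn_integral_cong simp: indicator_def)
  qed auto
  have "(\<integral>\<^sup>+t\<in>{0..<real n}. g t \<partial>lborel) = of_nat n * (\<integral>\<^sup>+t\<in>{0..<1}. g t \<partial>lborel)" for n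
  proof (induction n)
    case (Suc n)
    have "(\<integral>\<^sup>+t\<in>{0..<real (Suc n)}. g t \<partial>lborel) =
        (\<integral>\<^sup>+t\<in>{0..<real n}. g t \<partial>lborel) + (\<integral>\<^sup>+t\<in>{real n..<real n + 1}. g t \<partial>lborel)"
      by (subst nn_integral_add[symmetric]) (auto intro!: nn_integral_cong simp: indicator_def)
    then show ?case
      unfolding step Suc by (simp add: distrib_right add.commute)
  qed simp
  moreover have "(\<integral>\<^sup>+t\<in>{0..<real k}. g t \<partial>lborel) = of_nat k * (\<integral>\<^sup>+t\<in>{0..<1}. g (real k * t) \<partial>lborel)"
    using k by (subst nn_integral_real_affine[of _ "real k" 0])
      (auto intro!: arg_cong2[where f = "(*)"] nn_integral_cong
        simp: indicator_def ennreal_of_nat_eq_real_of_nat zero_le_mult_iff)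
  ultimately have "of_nat k * (\<integral>\<^sup>+t\<in>{0..<1}. g (real k * t) \<partial>lborel) = of_nat k * (\<integral>\<^sup>+t\<in>{0..<1}. g t \<partial>lborel)"
    by simp
  then have "(\<integral>\<^sup>+t\<in>{0..<1}. g (real k * t) \<partial>lborel) = (\<integral>\<^sup>+t\<in>{0..<1}. g t \<partial>lborel)"
    using k by (simp add: ennreal_mult_cancel_left)
  then show ?thesis
    by (simp add: nn_integral_unit_uniform)
qed

lemma nn_integral_unit_uniform_affine:
  fixes g :: "real \<Rightarrow> ennreal"
  assumes [measurable]: "g \<in> borel_measurable borel"
    and per: "\<And>t (k::int). g (t + of_int k) = g t"
    and k: "k > (0::nat)"
  shows "(\<integral>\<^sup>+t. g (real k * t + a) \<partial>unit_uniform) = (\<integral>\<^sup>+t. g t \<partial>unit_uniform)"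
proof -
  have "g (t + of_int j + a) = g (t + a)" for t and j :: int
    using per[of "t + a" j] by (simp add: algebra_simps)
  then have "(\<integral>\<^sup>+t. g (real k * t + a) \<partial>unit_uniform) = (\<integral>\<^sup>+t. g (t + a) \<partial>unit_uniform)"
    using k by (intro nn_integral_unit_uniform_dilate[of "\<lambda>t. g (t + a)"]) auto
  then show ?thesis
    using per by (simp add: nn_integral_unit_uniform_shift)
qed

text \<open>Inside the unit interval the set consists of one piece next to 0 and one next to 1, each
  of length \<open>p\<close>; \<open>p \<le> 1/2\<close> keeps them disjoint.\<close>

lemma nn_integral_dist_nearest_int_less:
  assumes "0 \<le> p" "p \<le> 1/2"
  shows "(\<integral>\<^sup>+t. indicator {t. dist_nearest_int t < p} t \<partial>unit_uniform) = ennreal (2 * p)"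
proof -
  have "dist_nearest_int t < p \<longleftrightarrow> t < p \<or> t > 1 - p" if "0 \<le> t" "t < 1" for t
  proof
    assume "dist_nearest_int t < p"
    then obtain k :: int where k: "\<bar>t - of_int k\<bar> < p"
      by (auto simp: dist_nearest_int_less_iff)
    have "- 1 < real_of_int k" "real_of_int k < 2"
      using k that assms by linarith+
    then have "k = 0 \<or> k = 1" by linarith
    then show "t < p \<or> t > 1 - p" using k by auto
  next
    assume "t < p \<or> t > 1 - p"
    then have "\<bar>t - of_int 0\<bar> < p \<or> \<bar>t - of_int 1\<bar> < p" using that by auto
    then show "dist_nearest_int t < p"
      unfolding dist_nearest_int_less_iff by blast
  qed
  then have "(\<integral>\<^sup>+t. indicator {t. dist_nearest_int t < p} t \<partial>unit_uniform)
     = (\<integral>\<^sup>+t. indicator {0..<p} t + indicator {1 - p<..<1} t \<partial>lborel)"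
    using assms by (subst nn_integral_unit_uniform) (auto intro!: nn_integral_cong simp: indicator_def)
  also have "\<dots> = ennreal p + ennreal p"
    using assms by (subst nn_integral_add) auto
  also have "\<dots> = ennreal (2 * p)"
    using assms by (simp flip: ennreal_plus)
  finally show ?thesis .
qed


section \<open>The approximation events and their pairwise independence\<close>

text \<open>The shift is the first coordinate, so that passing from pairs to sections puts almost
  every shift in the outer quantifier.\<close>

definition hit :: "(nat \<Rightarrow> real) \<Rightarrow> nat \<Rightarrow> (real \<times> real) set" where
  "hit \<psi> n = {(c, x). dist_nearest_int (real n * x + c) < \<psi> n}"

lemma sets_hit [measurable]: "hit \<psi> n \<in> sets (borel \<Otimes>\<^sub>M borel)"
proof -
  have "hit \<psi> n = {p \<in> space (borel \<Otimes>\<^sub>M borel).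
      dist_nearest_int (real n * snd p + fst p) < \<psi> n}"
    by (auto simp: hit_def space_pair_measure)
  also have "\<dots> \<in> sets (borel \<Otimes>\<^sub>M borel)"
    by measurable
  finally show ?thesis .
qed

text \<open>For fixed \<open>x\<close> the point \<open>c + real n * x\<close> is uniform modulo 1
  in \<open>c\<close>, so integrating over \<open>c\<close> first leaves a constant.\<close>

lemma prob_hit:
  assumes "0 \<le> \<psi> n" "\<psi> n \<le> 1/2"
  shows "unit_uniform_pair.prob (hit \<psi> n) = 2 * \<psi> n"
proof -
  let ?g = "\<lambda>t. indicator {t. dist_nearest_int t < \<psi> n} t :: ennreal"
  have g: "?g \<in> borel_measurable borel" by measurable
  have per: "?g (t + of_int k) = ?g t" for t and k :: int by (simp add: indicator_def)
  have "emeasure (unit_uniform \<Otimes>\<^sub>M unit_uniform) (hit \<psi> n) =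
      (\<integral>\<^sup>+x. \<integral>\<^sup>+c. indicator (hit \<psi> n) (c, x) \<partial>unit_uniform \<partial>unit_uniform)"
    by (subst unit_uniform_pair.nn_integral_snd) auto
  also have "\<dots> = (\<integral>\<^sup>+x. \<integral>\<^sup>+c. ?g (c + real n * x) \<partial>unit_uniform \<partial>unit_uniform)"
    by (auto intro!: nn_integral_cong simp: hit_def indicator_def add.commute)
  also have "\<dots> = (\<integral>\<^sup>+x. \<integral>\<^sup>+c. ?g c \<partial>unit_uniform \<partial>unit_uniform)"
    by (subst nn_integral_unit_uniform_shift[OF g per]) simp
  also have "\<dots> = ennreal (2 * \<psi> n)"
    by (subst nn_integral_dist_nearest_int_less[OF assms])
      (simp add: unit_uniform.emeasure_space_1)
  finally show ?thesis
    using assms by (simp add: measure_def)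
qed

text \<open>Translating \<^term>\<open>c\<close> by \<^term>\<open>real m * x\<close> removes \<^term>\<open>x\<close> from the first event and turns
  the second one into a condition on \<^term>\<open>c + real (n - m) * x\<close>, which is uniform in \<^term>\<open>x\<close>
  for every fixed \<^term>\<open>c\<close>.\<close>

lemma prob_hit_Int:
  assumes m: "0 \<le> \<psi> m" "\<psi> m \<le> 1/2" and n: "0 \<le> \<psi> n" "\<psi> n \<le> 1/2" and "m < n"
  shows "unit_uniform_pair.prob (hit \<psi> m \<inter> hit \<psi> n) =
    unit_uniform_pair.prob (hit \<psi> m) * unit_uniform_pair.prob (hit \<psi> n)"
proof -
  let ?g = "\<lambda>n t. indicator {t. dist_nearest_int t < \<psi> n} t :: ennreal"
  have g[measurable]: "?g n \<in> borel_measurable borel" for n by measurable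
  have per: "?g n (t + of_int k) = ?g n t" for n t and k :: int by (simp add: indicator_def)
  have "emeasure (unit_uniform \<Otimes>\<^sub>M unit_uniform) (hit \<psi> m \<inter> hit \<psi> n) =
      (\<integral>\<^sup>+x. \<integral>\<^sup>+c. indicator (hit \<psi> m \<inter> hit \<psi> n) (c, x) \<partial>unit_uniform \<partial>unit_uniform)"
    by (subst unit_uniform_pair.nn_integral_snd) auto
  \<comment> \<open>The second argument is \<open>c + real n * x\<close>, since \<open>m < n\<close>
    makes \<open>n - m\<close> a true difference.\<close>
  also have "\<dots> = (\<integral>\<^sup>+x. \<integral>\<^sup>+c. ?g m (c + real m * x) * ?g n (c + real m * x + real (n - m) * x)
      \<partial>unit_uniform \<partial>unit_uniform)"
    using \<open>m < n\<close>
    by (auto intro!: nn_integral_cong simp: hit_def indicator_def algebra_simps)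
  also have "\<dots> = (\<integral>\<^sup>+x. \<integral>\<^sup>+c. ?g m c * ?g n (c + real (n - m) * x) \<partial>unit_uniform \<partial>unit_uniform)"
  proof (rule nn_integral_cong)
    fix x
    let ?h = "\<lambda>c. ?g m c * ?g n (c + real (n - m) * x)"
    show "(\<integral>\<^sup>+c. ?h (c + real m * x) \<partial>unit_uniform) = (\<integral>\<^sup>+c. ?h c \<partial>unit_uniform)"
    proof (rule nn_integral_unit_uniform_shift[where g = "?h"])
      show "?h \<in> borel_measurable borel" by measurable
      show "?h (t + of_int k) = ?h t" for t and k :: int
        using per[of m t k] per[of n "t + real (n - m) * x" k]
        by (simp only: ac_simps)
    qed
  qed
  also have "\<dots> = (\<integral>\<^sup>+c. \<integral>\<^sup>+x. ?g m c * ?g n (c + real (n - m) * x) \<partial>unit_uniform \<partial>unit_uniform)"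
    by (rule unit_uniform_pair.Fubini') measurable
  also have "\<dots> = (\<integral>\<^sup>+c. ?g m c * (\<integral>\<^sup>+x. ?g n (real (n - m) * x + c) \<partial>unit_uniform) \<partial>unit_uniform)"
    by (subst nn_integral_cmult) (auto simp: add.commute)
  also have "\<dots> = (\<integral>\<^sup>+c. ?g m c * (\<integral>\<^sup>+x. ?g n x \<partial>unit_uniform) \<partial>unit_uniform)"
    using \<open>m < n\<close> by (subst nn_integral_unit_uniform_affine[OF g per]) auto
  also have "\<dots> = (\<integral>\<^sup>+c. ?g m c \<partial>unit_uniform) * (\<integral>\<^sup>+x. ?g n x \<partial>unit_uniform)"
    by (rule nn_integral_multc) measurable
  also have "\<dots> = ennreal (2 * \<psi> m) * ennreal (2 * \<psi> n)"
    by (simp only: nn_integral_dist_nearest_int_less[OF m] nn_integral_dist_nearest_int_less[OF n])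
  finally show ?thesis
    unfolding prob_hit[of \<psi>, OF m] prob_hit[of \<psi>, OF n] using m n by (simp add: measure_def enn2real_mult)
qed

section \<open>Solvability for almost every shift and point\<close>

lemma infinite_imp_has_at_least: "infinite A \<Longrightarrow> has_at_least R A"
  unfolding has_at_least_def
  by (metis infinite_arbitrarily_large real_nat_ceiling_ge)

lemma has_at_least_mono: "has_at_least R A \<Longrightarrow> A \<subseteq> B \<Longrightarrow> has_at_least R B"
  unfolding has_at_least_def by blast

lemma AE_has_at_least_approx_solutions:
  assumes nonneg: "\<And>n. n \<ge> 1 \<Longrightarrow> \<psi> n \<ge> 0"
    and div: "\<not> summable (\<lambda>n. \<psi> (Suc n))"
  shows "AE c in unit_uniform. AE x in unit_uniform. has_at_least R (approx_solutions \<psi> c x)"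
proof -
  \<comment> \<open>Up to radius \<open>1/2\<close> the probability of a hit is exactly twice the
    radius; solutions for \<open>\<phi>\<close> are solutions for \<open>\<psi>\<close>.\<close>
  define \<phi> where "\<phi> n = min (\<psi> n) (1/2)" for n
  have \<phi>: "0 \<le> \<phi> (Suc n)" "\<phi> (Suc n) \<le> 1/2" for n
    using nonneg[of "Suc n"] by (auto simp: \<phi>_def)
  \<comment> \<open>If the truncated series converged, its terms would eventually be below
    \<open>1/2\<close>, where the truncation changes nothing.\<close>
  have "\<not> summable (\<lambda>n. \<phi> (Suc n))"
  proof
    assume sum: "summable (\<lambda>n. \<phi> (Suc n))"
    then have "(\<lambda>n. \<phi> (Suc n)) \<longlonglongrightarrow> 0" by (rule summable_LIMSEQ_zero)
    then have "\<forall>\<^sub>F n in sequentially. \<phi> (Suc n) < 1/2"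
      by (rule order_tendstoD) simp
    then have "\<forall>\<^sub>F n in sequentially. \<phi> (Suc n) = \<psi> (Suc n)"
      by eventually_elim (simp add: \<phi>_def min_def split: if_splits)
    then have "summable (\<lambda>n. \<phi> (Suc n)) \<longleftrightarrow> summable (\<lambda>n. \<psi> (Suc n))"
      by (rule summable_cong)
    with sum div show False by simp
  qed
  then have "\<not> summable (\<lambda>n. unit_uniform_pair.prob (hit \<phi> (Suc n)))"
    using \<phi> by (simp add: prob_hit)
  then have "AE p in unit_uniform \<Otimes>\<^sub>M unit_uniform. infinite {n. p \<in> hit \<phi> (Suc n)}"
    by (intro unit_uniform_pair.borel_cantelli_pairwise_indep prob_hit_Int \<phi>) auto
  then have "AE c in unit_uniform. AE x in unit_uniform. infinite {n. (c, x) \<in> hit \<phi> (Suc n)}"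
    by (rule unit_uniform_pair.AE_pair)
  then show ?thesis
  proof eventually_elim
    case (elim c)
    then show ?case
    proof eventually_elim
      case (elim x)
      then have "infinite (Suc ` {n. (c, x) \<in> hit \<phi> (Suc n)})"
        by (simp add: finite_image_iff)
      moreover have "Suc ` {n. (c, x) \<in> hit \<phi> (Suc n)} \<subseteq> approx_solutions \<psi> c x"
        by (auto simp: hit_def approx_solutions_def \<phi>_def)
      ultimately show ?case
        by (blast intro: has_at_least_mono infinite_imp_has_at_least)
    qed
  qed
qed

section \<open>Open sets: joint openness, inner approximation, equidistribution\<close>

text \<open>Having enough solutions is witnessed by a finite set \<open>F\<close> of indices, and
  each \<open>F\<close> imposes finitely many strict inequalities between continuous functions of
  \<open>(c, x)\<close>.\<close>

lemma open_has_at_least_approx_solutions: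
  "open {(c, x). has_at_least R (approx_solutions \<psi> c x)}"
proof -
  let ?I = "{F. finite F \<and> R \<le> real (card F) \<and> F \<subseteq> {1..}}"
  let ?V = "\<lambda>F. \<Inter>n\<in>F. {p. dist_nearest_int (real n * snd p + fst p) < \<psi> n}"
  have "{(c, x). has_at_least R (approx_solutions \<psi> c x)} = (\<Union>F\<in>?I. ?V F)"
  proof (intro set_eqI, clarify)
    fix c x
    have "F \<subseteq> approx_solutions \<psi> c x \<longleftrightarrow> F \<subseteq> {1..} \<and> (c, x) \<in> ?V F" for F
      by (auto simp: approx_solutions_def)
    then show "(c, x) \<in> {(c, x). has_at_least R (approx_solutions \<psi> c x)} \<longleftrightarrow> (c, x) \<in> (\<Union>F\<in>?I. ?V F)"
      unfolding has_at_least_def by auto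
  qed
  moreover have "open (?V F)" if "finite F" for F
    using that by (intro open_INT ballI open_Collect_less continuous_intros) auto
  ultimately show ?thesis
    by (simp only:) (rule open_UN, simp)
qed

text \<open>Inner regularity by closed sets, which are compact here because \<open>U\<close> is
  bounded. Compactness later supplies a uniform radius around \<open>K\<close>.\<close>

lemma compact_inner_approximation:
  fixes U :: "real set"
  assumes "open U" "bounded U" "t < measure lebesgue U"
  obtains K where "compact K" "K \<subseteq> U" "t < measure lebesgue K"
proof -
  have U: "U \<in> lmeasurable"
    using assms by (simp add: lmeasurable_open)
  obtain K where K: "closed K" "K \<subseteq> U" "U - K \<in> lmeasurable"
      "emeasure lebesgue (U - K) < ennreal (measure lebesgue U - t)"
    using sets_lebesgue_inner_closed[of U "measure lebesgue U - t"] assms U by auto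
  have "compact K"
    using K assms bounded_subset compact_eq_bounded_closed by blast
  then have "measure lebesgue (U - K) = measure lebesgue U - measure lebesgue K"
    using U K by (intro measurable_measure_Diff) (auto intro: lmeasurable_compact fmeasurableD)
  moreover have "measure lebesgue (U - K) < measure lebesgue U - t"
    using K assms by (simp add: emeasure_eq_measure2 ennreal_less_iff)
  ultimately show ?thesis
    using K \<open>compact K\<close> by (intro that[of K]) auto
qed

text \<open>Dropping the null point 0 replaces the half-open unit interval by an open one, so the
  intersection with \<open>A\<close> is itself open.\<close>

lemma measure_lebesgue_eq_1_if_AE:
  assumes "open A" "AE x in unit_uniform. x \<in> A"
  shows "measure lebesgue (A \<inter> {0<..<1}) = 1"
proof -
  have [measurable]: "A \<in> sets borel" using assms by auto
  have "AE x in lborel. x \<in> {0..<1} \<longrightarrow> x \<in> A"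
    using assms by (simp add: AE_uniform_measure)
  moreover have "AE x in lborel. x \<noteq> (0::real)"
    by (rule AE_lborel_singleton)
  ultimately have "AE x in lborel. x \<in> A \<inter> {0<..<1} \<longleftrightarrow> x \<in> {0..<1}"
    by eventually_elim auto
  then have "measure lborel (A \<inter> {0<..<1}) = measure lborel {0..<1::real}"
    by (intro measure_eq_AE) auto
  then show ?thesis
    by (subst measure_completion) auto
qed

text \<open>For \<open>t < 1\<close> take a compact \<open>K\<close> inside \<open>G\<close> of
  measure above \<open>t\<close>. A fine enough grid has every cell meeting \<open>K\<close>
  contained in \<open>G\<close>; these cells cover \<open>K\<close>, so their total length, which is
  the frequency of visits to them, exceeds \<open>t\<close>.\<close>

lemma equidistributed_mod_1_open:
  assumes equi: "equidistributed_mod_1 y" and "open G" and full: "AE c in unit_uniform. c \<in> G"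
  shows "has_asymptotic_density {m \<in> {1..}. frac (y m) \<in> G} 1"
proof -
  let ?S = "{m \<in> {1..}. frac (y m) \<in> G}"
  have lower: "\<forall>\<^sub>F N in sequentially. t < real (card (?S \<inter> {1..N})) / real N" if "t < 1" for t
  proof -
    let ?U = "G \<inter> {0<..<1}"
    have "open ?U" "bounded ?U" "t < measure lebesgue ?U"
      using \<open>open G\<close> \<open>t < 1\<close> bounded_subset[of "{0<..<1::real}" ?U]
        measure_lebesgue_eq_1_if_AE[OF \<open>open G\<close> full]
      by auto
    then obtain K where K: "compact K" "K \<subseteq> ?U" "t < measure lebesgue K"
      by (rule compact_inner_approximation)
    obtain e where e: "e > 0" "(\<Union>x\<in>K. ball x e) \<subseteq> G"
      using compact_subset_open_imp_ball_epsilon_subset[of K G] K \<open>open G\<close> by auto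
    obtain n where n: "n > 0" "1 / real n < e"
      using nat_approx_posE[OF \<open>e > 0\<close>] by (metis of_nat_0_less_iff zero_less_Suc)
    \<comment> \<open>Half-open cells match the intervals in the definition of equidistribution and
      do not overlap.\<close>
    define J where "J i = {real i / real n..<(real i + 1) / real n}" for i
    define I where "I = {i. i < n \<and> J i \<inter> K \<noteq> {}}"
    have fin: "finite I" by (simp add: I_def)
    have J_lmeasurable: "J i \<in> lmeasurable" for i
      by (rule bounded_set_imp_lmeasurable)
        (auto simp: J_def intro: bounded_subset[of "{real i / real n..(real i + 1) / real n}"])
    \<comment> \<open>The cell of a nonnegative point is determined by a floor; this yields both the
      covering of \<open>K\<close> and the disjointness used when counting visits.\<close>
    have J_iff: "x \<in> J i \<longleftrightarrow> i = nat \<lfloor>real n * x\<rfloor>" if "x \<ge> 0" for x i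
    proof -
      have "x \<in> J i \<longleftrightarrow> real i \<le> real n * x \<and> real n * x < real i + 1"
        using n by (auto simp: J_def field_simps)
      also have "\<dots> \<longleftrightarrow> \<lfloor>real n * x\<rfloor> = int i"
        by (simp add: floor_eq_iff)
      also have "\<dots> \<longleftrightarrow> i = nat \<lfloor>real n * x\<rfloor>"
        using that by auto
      finally show ?thesis .
    qed
    have "K \<subseteq> (\<Union>i\<in>I. J i)"
    proof
      fix x assume "x \<in> K"
      then have x: "0 < x" "x < 1" using K by auto
      define i where "i = nat \<lfloor>real n * x\<rfloor>"
      have "x \<in> J i" using x by (simp add: J_iff i_def)
      moreover have "i < n"
        using x n unfolding i_def by (simp add: nat_less_iff floor_less_iff)
      ultimately show "x \<in> (\<Union>i\<in>I. J i)"
        using \<open>x \<in> K\<close> by (auto simp: I_def)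
    qed
    then have "measure lebesgue K \<le> measure lebesgue (\<Union>i\<in>I. J i)"
      using fin K by (intro measure_mono_fmeasurable fmeasurable.finite_UN)
        (auto simp: J_lmeasurable intro: lmeasurable_compact fmeasurableD)
    also have "\<dots> \<le> (\<Sum>i\<in>I. measure lebesgue (J i))"
      using fin by (intro measure_UNION_le) (auto simp: J_def)
    also have "\<dots> = real (card I) / real n"
      using n by (simp add: J_def divide_right_mono) (simp add: field_simps)
    finally have card_I: "t < real (card I) / real n"
      using K by simp
    have J_sub: "J i \<subseteq> G" if i: "i \<in> I" for i
    proof
      fix z assume z: "z \<in> J i"
      obtain x where x: "x \<in> J i" "x \<in> K" using i by (auto simp: I_def)
      have "\<bar>x - z\<bar> < 1 / real n"
        using x z by (auto simp: J_def add_divide_distrib)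
      then have "z \<in> ball x e" using n by (simp add: dist_real_def)
      then show "z \<in> G" using x e(2) by blast
    qed
    define cnt where "cnt i N = card {m \<in> {1..N}. frac (y m) \<in> J i}" for i N
    have "(\<lambda>N. real (cnt i N) / real N) \<longlonglongrightarrow> 1 / real n" if "i \<in> I" for i
    proof -
      let ?a = "real i / real n" and ?b = "(real i + 1) / real n"
      have "0 \<le> ?a \<and> ?a < ?b \<and> ?b \<le> 1"
        using that n by (auto simp: I_def field_simps)
      then have "(\<lambda>N. real (cnt i N) / real N) \<longlonglongrightarrow> ?b - ?a"
        using equi unfolding equidistributed_mod_1_def cnt_def J_def by blast
      then show ?thesis
        by (simp add: diff_divide_distrib[symmetric])
    qed
    then have "(\<lambda>N. \<Sum>i\<in>I. real (cnt i N) / real N) \<longlonglongrightarrow> (\<Sum>i\<in>I. 1 / real n)"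
      by (intro tendsto_sum) auto
    then have "\<forall>\<^sub>F N in sequentially. t < (\<Sum>i\<in>I. real (cnt i N) / real N)"
      using card_I by (intro order_tendstoD(1)) auto
    then show ?thesis
    proof eventually_elim
      case (elim N)
      have "(\<Sum>i\<in>I. cnt i N) = card (\<Union>i\<in>I. {m \<in> {1..N}. frac (y m) \<in> J i})"
        unfolding cnt_def using fin
        by (intro card_UN_disjoint[symmetric]) (auto simp: J_iff)
      also have "\<dots> \<le> card (?S \<inter> {1..N})"
        using J_sub by (intro card_mono) auto
      finally have "real (\<Sum>i\<in>I. cnt i N) \<le> real (card (?S \<inter> {1..N}))"
        by (rule of_nat_mono)
      then have "(\<Sum>i\<in>I. real (cnt i N) / real N) \<le> real (card (?S \<inter> {1..N})) / real N"
        by (simp add: sum_divide_distrib[symmetric] divide_right_mono)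
      with elim show ?case by linarith
    qed
  qed
  \<comment> \<open>At \<open>N = 0\<close> the quotient is 0, as division by zero gives 0.\<close>
  have upper: "real (card (?S \<inter> {1..N})) / real N \<le> 1" for N
  proof -
    have "card (?S \<inter> {1..N}) \<le> card {1..N}"
      by (intro card_mono) auto
    then show ?thesis by (simp add: divide_le_eq)
  qed
  show ?thesis
    unfolding has_asymptotic_density_def
  proof (rule order_tendstoI)
    show "\<forall>\<^sub>F N in sequentially. real (card (?S \<inter> {1..N})) / real N < t" if "1 < t" for t
      using that by (intro always_eventually allI le_less_trans[OF upper])
  qed (rule lower)
qed

section \<open>The open set of good shifts and its visits by the sequence\<close>

theorem theorem1p4:
  fixes y :: "nat \<Rightarrow> real" and \<psi> :: "nat \<Rightarrow> real" and R \<epsilon> :: real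
  assumes "equidistributed_mod_1 y"
    and "\<And>n. n \<ge> 1 \<Longrightarrow> \<psi> n \<ge> 0"
    and "\<not> summable (\<lambda>n. \<psi> (Suc n))"
    and "R > 0" and "\<epsilon> > 0"
  shows "\<exists>S. S \<subseteq> {1..} \<and> has_asymptotic_density S 1 \<and>
           (\<forall>m\<in>S. periodic_measure {x. has_at_least R (approx_solutions \<psi> (y m) x)} \<ge> 1 - \<epsilon>)"
proof -
  let ?W = "\<lambda>c. {x. has_at_least R (approx_solutions \<psi> c x)}"
  let ?V = "{(c, x). has_at_least R (approx_solutions \<psi> c x)}"
  \<comment> \<open>The strict inequality leaves room for a compact set of measure still above
    \<open>1 - \<epsilon>\<close>, which makes \<open>G\<close> open.\<close>
  define G where "G = {c. 1 - \<epsilon> < measure lebesgue (?W c \<inter> {0<..<1})}"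
  have open_W: "open (?W c)" for c
  proof -
    have "?W c = Pair c -` ?V" by auto
    also have "open \<dots>"
      by (intro open_vimage open_has_at_least_approx_solutions continuous_intros)
    finally show ?thesis .
  qed
  have bounded_W: "bounded (?W c \<inter> {0<..<1})" for c
    by (rule bounded_subset[of "{0<..<1}"]) auto
  have lmeasurable_W: "?W c \<inter> {0<..<1} \<in> lmeasurable" for c
    using open_W bounded_W by (intro lmeasurable_open) auto
  have "open G"
    unfolding open_dist
  proof
    fix c assume "c \<in> G"
    then have "1 - \<epsilon> < measure lebesgue (?W c \<inter> {0<..<1})"
      by (simp only: G_def mem_Collect_eq)
    with open_Int[OF open_W open_greaterThanLessThan] bounded_W
    obtain K where K: "compact K" "K \<subseteq> ?W c \<inter> {0<..<1}" "1 - \<epsilon> < measure lebesgue K"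
      by (rule compact_inner_approximation)
    \<comment> \<open>Tube argument: a uniform neighbourhood of \<open>{c} \<times> K\<close> stays
      in the open set of solvable pairs, so the same \<open>K\<close> serves every shift
      \<open>c'\<close> close to \<open>c\<close>.\<close>
    have "compact ({c} \<times> K)" "{c} \<times> K \<subseteq> ?V"
      using K by (auto intro: compact_Times)
    then obtain e where e: "e > 0" "(\<Union>p\<in>{c} \<times> K. ball p e) \<subseteq> ?V"
      by (rule compact_subset_open_imp_ball_epsilon_subset[OF _ open_has_at_least_approx_solutions])
    have "c' \<in> G" if "dist c' c < e" for c'
    proof -
      have "(c', x) \<in> ball (c, x) e" for x
        using that by (simp add: dist_Pair_Pair dist_commute)
      then have "(c', x) \<in> ?V" if "x \<in> K" for x
        using e(2) that by blast
      then have "K \<subseteq> ?W c' \<inter> {0<..<1}"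
        using K(2) by auto
      then have "measure lebesgue K \<le> measure lebesgue (?W c' \<inter> {0<..<1})"
        using K lmeasurable_W
        by (intro measure_mono_fmeasurable) (auto intro: lmeasurable_compact fmeasurableD)
      then show ?thesis
        using K by (simp add: G_def)
    qed
    with \<open>e > 0\<close> show "\<exists>e>0. \<forall>c'. dist c' c < e \<longrightarrow> c' \<in> G" by blast
  qed
  moreover have "AE c in unit_uniform. c \<in> G"
  proof -
    have "AE c in unit_uniform. AE x in unit_uniform. has_at_least R (approx_solutions \<psi> c x)"
      using assms(2,3) by (rule AE_has_at_least_approx_solutions)
    then show ?thesis
    proof eventually_elim
      case (elim c)
      then have "measure lebesgue (?W c \<inter> {0<..<1}) = 1"
        by (intro measure_lebesgue_eq_1_if_AE open_W) simp
      with \<open>\<epsilon> > 0\<close> have "1 - \<epsilon> < measure lebesgue (?W c \<inter> {0<..<1})"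
        by linarith
      then show ?case
        unfolding G_def by (rule CollectI)
    qed
  qed
  ultimately have "has_asymptotic_density {m \<in> {1..}. frac (y m) \<in> G} 1"
    by (intro equidistributed_mod_1_open assms)
  moreover have "periodic_measure (?W (y m)) \<ge> 1 - \<epsilon>" if "frac (y m) \<in> G" for m
  proof -
    \<comment> \<open>Only the shift modulo 1 matters, so membership of \<open>frac (y m)\<close> in
      \<open>G\<close> controls the solutions for \<open>y m\<close> itself.\<close>
    have "dist_nearest_int (real n * x + y m) = dist_nearest_int (real n * x + frac (y m))" for n x
      using dist_nearest_int_add_int[of "real n * x + frac (y m)" "\<lfloor>y m\<rfloor>"]
      by (simp add: frac_def)
    then have "?W (y m) = ?W (frac (y m))"
      by (simp add: approx_solutions_def)
    then have "1 - \<epsilon> < measure lebesgue (?W (y m) \<inter> {0<..<1})"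
      using that by (simp add: G_def)
    also have "\<dots> \<le> periodic_measure (?W (y m))"
      unfolding periodic_measure_def
    proof (rule measure_mono_fmeasurable)
      show "?W (y m) \<inter> {0..<1} \<in> lmeasurable"
        using open_W[of "y m"]
        by (intro bounded_set_imp_lmeasurable bounded_subset[of "{0..1}" "?W (y m) \<inter> {0..<1}"]) auto
    qed (use lmeasurable_W fmeasurableD in auto)
    finally show ?thesis by simp
  qed
  ultimately show ?thesis
    by (intro exI[of _ "{m \<in> {1..}. frac (y m) \<in> G}"]) auto
qed

end
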